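(* Let $S=S(p_1,\ldots,p_m)$ be a system in $\mathsf{Sat}_n^{(l)}$, i.e. $p_1,\dots,p_m\in\mathbb{CL}_n^{(l)}$. Put $\mathcal{P}^{\varnothing}=\mathcal{N}(\{p_1,\ldots,p_m\})$ and divide $\mathcal{P}^{\varnothing}$ into $$\mathcal{P}_j^{\varnothing}=\{p\in\mathcal{P}^{\varnothing}\mid \pi_{\min}(p)=j\}\qquad(j=1,\ldots,n+1).$$ For an integer $j$ from $1$ to $n+1$, recursively define a family $$\mathbf{P}_j=\{\mathcal{P}_j^{\alpha_i\cdots\alpha_{j-1}}\mid 1\le i\le j-1,\ (\alpha_i,\ldots,\alpha_{j-1})\in\mathbb{F}_2^{j-i}\}$$ (indexed by $i$ and the tuple $(\alpha_i,\dots,\alpha_{j-1})$), whose elements are subsets of $\mathbb{BP}_{j,n}$, as follows. Set $\mathbf{P}_1=\emptyset$. When $\mathbf{P}_{j-1}$ is determined, the elements of $\mathbf{P}_j$ are $$\mathcal{P}_j^{\alpha_i\cdots\alpha_{j-2}\alpha_{j-1}}=\mathcal{N}\bigl(\{p|_{x_{j-1}=\alpha_{j-1}}\mid p\in\mathcal{P}_{j-1}^{\alpha_i\cdots\alpha_{j-2}}\}\bigr),\qquad (\ast)$$ where $\mathcal{P}_{j-1}^{\alpha_i\cdots\alpha_{j-2}}$ means $\mathcal{P}_{j-1}^{\varnothing}$ if $i=j-1$. Let $P_1=p_1\vee\cdots\vee p_m$ and, for $2\le j\le n+1$, $P_j=\prod_{\alpha\in\mathbb{F}_2}\bigl(P_{j-1}|_{x_{j-1}=\alpha}\bigr)$.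 Then, for $1\le j\le n+1$, $$P_j=\Biggl(\bigwedge_{\alpha_{j-1}\in\mathbb{F}_2}\Biggl[\Bigl(\cdots\Bigl(\bigwedge_{\alpha_2\in\mathbb{F}_2}\Bigl[\Bigl(\bigwedge_{\alpha_1\in\mathbb{F}_2}F(\mathcal{P}_j^{\alpha_1\cdots\alpha_{j-1}})\Bigr)\vee F(\mathcal{P}_j^{\alpha_2\cdots\alpha_{j-1}})\Bigr]\Bigr)\cdots\Bigr)\vee F(\mathcal{P}_j^{\alpha_{j-1}})\Biggr]\Biggr)\vee F(\mathcal{P}_j^{\varnothing}\cup\cdots\cup\mathcal{P}_{n+1}^{\varnothing}).$$ (The formula reads $P_1=F(\mathcal{P}_1^{\varnothing}\cup\cdots\cup\mathcal{P}_{n+1}^{\varnothing})$ for $j=1$; $P_2=(F(\mathcal{P}_2^{0})\wedge F(\mathcal{P}_2^{1}))\vee F(\mathcal{P}_2^{\varnothing}\cup\cdots\cup\mathcal{P}_{n+1}^{\varnothing})$ for $j=2$; $P_3=\bigl(((F(\mathcal{P}_3^{00})\wedge F(\mathcal{P}_3^{10}))\vee F(\mathcal{P}_3^{0}))\wedge((F(\mathcal{P}_3^{01})\wedge F(\mathcal{P}_3^{11}))\vee F(\mathcal{P}_3^{1}))\bigr)\vee F(\mathcal{P}_3^{\varnothing}\cup\cdots\cup\mathcal{P}_{n+1}^{\varnothing})$ for $j=3$; and so on.) Moreover the families $\mathbf{P}_j$ have the following properties. (A) $|\mathbf{P}_j|=2^j-2$. (B) $|\mathcal{P}_j^{\alpha_i\cdots\alpha_{j-1}}|\le|\mathcal{P}_{j-1}^{\alpha_i\cdots\alpha_{j-2}}|$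 for $j\ge2$. (C) The computing time of $(\ast)$ for all elements of $\mathbf{P}_j$ is bounded by $$O\Bigl(l\sum_{i=1}^{j-1}\ \sum_{(\alpha_i,\ldots,\alpha_{j-2})\in\mathbb{F}_2^{j-1-i}}|\mathcal{P}_{j-1}^{\alpha_i\cdots\alpha_{j-2}}|\Bigr).$$
   Context: $\mathbb{F}_2=\{0,1\}$ is the two-element field. The Boolean polynomial ring is $\mathbb{BP}_n=\mathbb{F}_2[x_1,\ldots,x_n]/(x_1^2+x_1,\ldots,x_n^2+x_n)$; its elements are called Boolean polynomials and are identified with functions $\mathbb{F}_2^n\to\mathbb{F}_2$. For $1\le i\le n+1$ and $1\le j\le n$, $\mathbb{BP}_{i,j}$ is the subring of Boolean polynomials in the variables $x_i,\ldots,x_j$ (equal to $\mathbb{F}_2$ if $i>j$). $p|_{x_i=\alpha}$ denotes substitution of $\alpha\in\mathbb{F}_2$ for $x_i$. For Boolean polynomials, $p\wedge q=pq$ and $p\vee q=(p+1)(q+1)+1$; so $p_1\vee\cdots\vee p_m=(p_1+1)\cdots(p_m+1)+1$. A system $S(p_1,\ldots,p_m)$ is the system of equations $p_1=\cdots=p_m=0$ ($p_i\in\mathbb{BP}_n$). A literal is $x_i$ or $x_i+1$. $\mathbb{CL}_n$ is the set consisting of $0$, $1$ and all products $l_1\cdots l_k$ ($k\ge1$) of literals, where the literals may be assumed to satisfy $l_a\notin\{l_b,l_b+1\}$ for $a\ne b$; its elements are called clauses. For a positive integer $l$, $\mathbb{CL}_n^{(l)}=\{c_1+\cdots+c_l\mid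 c_1,\ldots,c_l\in\mathbb{CL}_n\}$, and $\mathsf{Sat}_n^{(l)}$ is the set of systems $S(c_1,\ldots,c_m)$ with all $c_i\in\mathbb{CL}_n^{(l)}$. Variables are ordered by subscript. $\pi_{\min}(p)$ is the subscript of the minimum variable appearing in $p$, with $\pi_{\min}(p)=n+1$ if $p$ is constant. For a subset $\mathcal{P}\subset\mathbb{BP}_n$, $F(\mathcal{P})=\bigvee_{p\in\mathcal{P}}p=\prod_{p\in\mathcal{P}}(p+1)+1$, with $F(\emptyset)=0$. The map $\mathcal{N}$ on subsets of $\mathbb{BP}_n$ is $\mathcal{N}(\mathcal{P})=\{1\}$ if $1\in\mathcal{P}$, and $\mathcal{N}(\mathcal{P})=\mathcal{P}\setminus\{0\}$ otherwise. $|A|$ is the number of elements of $A$ (for a family, the number of indexed members). $\mathbb{F}_2^0$ has exactly one element, the empty tuple (and the corresponding superscript is $\varnothing$). Cost conventions: a polynomial of $\mathbb{CL}_n^{(l)}$ is given as a sum of $l$ clauses; a clause is stored as a hash set ($\emptyset$ for $0$, $\{1\}$ for $1$, and $\{l_1,\ldots,l_k\}$ for $l_1\cdots l_k$); search and delete in a hash set cost $O(1)$; the computation of $\mathcal{N}$ (search of $1$ and delete of $0$) is considered to cost $O(1)$.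
   Formalization: In (C), computing (∗) from an empty set is charged no time; with a positive charge for each application of 𝒩 the bound fails, e.g. for the single polynomial x₁⋯xₙ, where the bound is O(1) but 2^j−2 sets occur. Inserting a polynomial into a set is counted as one step. *)

theory Defs
  imports
    "HOL-Library.Z2"
    "HOL-Library.Poly_Mapping"
    "HOL-Library.State_Monad"
begin

section \<open>The Boolean polynomial ring\<close>

text \<open>
  Modulo the relations \<open>x\<^sub>i\<^sup>2 + x\<^sub>i\<close> every monomial is congruent to the product of the
  variables occurring in it.  So a monomial is a finite set of subscripts, the product of two
  monomials is the union, and Boolean polynomials are the formal \<open>F\<^sub>2\<close>-linear combinations of
  such monomials.  All polynomials live in one type with variables \<open>x\<^sub>0, x\<^sub>1, \<dots>\<close>; the ring
  in the variables \<open>x\<^sub>i, \<dots>, x\<^sub>j\<close> is the subring \<open>BP i j\<close> below.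
\<close>

typedef bmonom = "{A :: nat set. finite A}"
  morphisms vars_of bmonom
  by auto

setup_lifting type_definition_bmonom

instantiation bmonom :: comm_monoid_add
begin

lift_definition zero_bmonom :: bmonom is "{}" by simp

lift_definition plus_bmonom :: "bmonom \<Rightarrow> bmonom \<Rightarrow> bmonom" is "(\<union>)" by simp

instance by standard (transfer; auto)+

end

type_synonym bpoly = "bmonom \<Rightarrow>\<^sub>0 bit"

definition Const :: "bit \<Rightarrow> bpoly" where
  "Const c = Poly_Mapping.single 0 c"

definition X :: "nat \<Rightarrow> bpoly" where
  "X i = Poly_Mapping.single (bmonom {i}) 1"

definition vars :: "bpoly \<Rightarrow> nat set" where
  "vars p = (\<Union>u \<in> Poly_Mapping.keys p. vars_of u)"

definition BP :: "nat \<Rightarrow> nat \<Rightarrow> bpoly set" where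
  "BP i j = {p. vars p \<subseteq> {i..j}}"

subsection \<open>\<open>BP 1 n\<close> is the quotient of the polynomial ring by the field equations\<close>

text \<open>
  \<open>(nat \<Rightarrow>\<^sub>0 nat) \<Rightarrow>\<^sub>0 bit\<close> is the ordinary polynomial ring over \<open>F\<^sub>2\<close>.
  \<open>reduce\<close> restricts to a surjective ring homomorphism from \<open>F\<^sub>2[x\<^sub>1, \<dots>, x\<^sub>n]\<close>
  onto \<open>BP 1 n\<close> whose kernel is the ideal generated by \<open>x\<^sub>1\<^sup>2 + x\<^sub>1, \<dots>, x\<^sub>n\<^sup>2 + x\<^sub>n\<close>.
\<close>

definition polynomials :: "nat \<Rightarrow> ((nat \<Rightarrow>\<^sub>0 nat) \<Rightarrow>\<^sub>0 bit) set" where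
  "polynomials n = {p. \<forall>u \<in> Poly_Mapping.keys p. Poly_Mapping.keys u \<subseteq> {1..n}}"

definition indet :: "nat \<Rightarrow> (nat \<Rightarrow>\<^sub>0 nat) \<Rightarrow>\<^sub>0 bit" where
  "indet i = Poly_Mapping.single (Poly_Mapping.single i 1) 1"

definition field_ideal :: "nat \<Rightarrow> ((nat \<Rightarrow>\<^sub>0 nat) \<Rightarrow>\<^sub>0 bit) set" where
  "field_ideal n = {\<Sum>i = 1..n. c i * (indet i ^ 2 + indet i) | c. \<forall>i. c i \<in> polynomials n}"

definition reduce :: "((nat \<Rightarrow>\<^sub>0 nat) \<Rightarrow>\<^sub>0 bit) \<Rightarrow> bpoly" where
  "reduce p = (\<Sum>u \<in> Poly_Mapping.keys p.
     Poly_Mapping.single (bmonom (Poly_Mapping.keys u)) (Poly_Mapping.lookup p u))"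

definition relabel :: "('a \<Rightarrow> 'b) \<Rightarrow> ('a \<Rightarrow>\<^sub>0 bit) \<Rightarrow> ('b \<Rightarrow>\<^sub>0 bit)" where
  "relabel f p = (\<Sum>u \<in> Poly_Mapping.keys p. Poly_Mapping.single (f u) (Poly_Mapping.lookup p u))"

lemma relabel_superset:
  assumes "finite A" "Poly_Mapping.keys p \<subseteq> A"
  shows "relabel f p = (\<Sum>u \<in> A. Poly_Mapping.single (f u) (Poly_Mapping.lookup p u))"
  unfolding relabel_def using assms
  by (intro sum.mono_neutral_left) (auto simp: in_keys_iff simp del: bit_not_zero_iff)

lemma relabel_0 [simp]: "relabel f 0 = 0"
  by (simp add: relabel_def)

lemma relabel_add: "relabel f (p + q) = relabel f p + relabel f q"
proof -
  let ?A = "Poly_Mapping.keys p \<union> Poly_Mapping.keys q"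
  have "relabel f r = (\<Sum>u \<in> ?A. Poly_Mapping.single (f u) (Poly_Mapping.lookup r u))"
    if "Poly_Mapping.keys r \<subseteq> ?A" for r
    using that by (intro relabel_superset) auto
  then show ?thesis
    using keys_add[of p q] by (simp only: lookup_add single_add sum.distrib Un_upper1 Un_upper2)
qed

lemma relabel_single [simp]: "relabel f (Poly_Mapping.single u c) = Poly_Mapping.single (f u) c"
  by (subst relabel_superset[of "{u}"]) auto

lemma relabel_sum: "relabel f (\<Sum>i \<in> A. g i) = (\<Sum>i \<in> A. relabel f (g i))"
  by (induction A rule: infinite_finite_induct) (auto simp: relabel_add)

lemma relabel_id: "relabel (\<lambda>u. u) p = p"
proof (rule poly_mapping_eqI)
  fix k
  have "Poly_Mapping.lookup (relabel (\<lambda>u. u) p) k =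
      (\<Sum>u \<in> Poly_Mapping.keys p. (Poly_Mapping.lookup p u when u = k))"
    by (simp add: relabel_def lookup_sum lookup_single)
  also have "\<dots> = Poly_Mapping.lookup p k"
    by (simp add: when_def in_keys_iff del: bit_not_zero_iff)
  finally show "Poly_Mapping.lookup (relabel (\<lambda>u. u) p) k = Poly_Mapping.lookup p k" .
qed

lemma relabel_relabel: "relabel g (relabel f p) = relabel (\<lambda>u. g (f u)) p"
  by (simp add: relabel_def[of f p] relabel_sum) (simp add: relabel_def)

lemma reduce_eq_relabel: "reduce = relabel (\<lambda>u. bmonom (Poly_Mapping.keys u))"
  by (simp add: fun_eq_iff reduce_def relabel_def)

lemma char2 [simp]: "p + p = (0 :: 'a \<Rightarrow>\<^sub>0 bit)"
  by (rule poly_mapping_eqI) (simp add: lookup_add)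

lemma keys_add_nat: "Poly_Mapping.keys (u + v) = Poly_Mapping.keys u \<union> Poly_Mapping.keys (v :: 'a \<Rightarrow>\<^sub>0 nat)"
  by (auto simp: in_keys_iff lookup_add)

lemma bmonom_Un: "finite A \<Longrightarrow> finite B \<Longrightarrow> bmonom (A \<union> B) = bmonom A + bmonom B"
  by (simp add: plus_bmonom.abs_eq eq_onp_def)

lemma reduce_add: "reduce (p + q) = reduce p + reduce q"
  by (simp add: reduce_eq_relabel relabel_add)

lemma reduce_single:
  "reduce (Poly_Mapping.single u c) = Poly_Mapping.single (bmonom (Poly_Mapping.keys u)) c"
  by (simp add: reduce_eq_relabel)

lemma reduce_mult: "reduce (p * q) = reduce p * reduce q"
proof -
  have "reduce (p * q) = reduce (relabel (\<lambda>u. u) p * relabel (\<lambda>u. u) q)"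
    by (simp add: relabel_id)
  also have "\<dots> = (\<Sum>u \<in> Poly_Mapping.keys p. \<Sum>v \<in> Poly_Mapping.keys q.
      Poly_Mapping.single (bmonom (Poly_Mapping.keys (u + v)))
        (Poly_Mapping.lookup p u * Poly_Mapping.lookup q v))"
    by (simp add: relabel_def sum_product mult_single reduce_eq_relabel)
      (simp flip: relabel_def add: relabel_sum)
  also have "\<dots> = reduce p * reduce q"
    by (simp add: reduce_def sum_product mult_single keys_add_nat bmonom_Un)
  finally show ?thesis .
qed

lemma reduce_one: "reduce 1 = 1"
proof -
  have "bmonom {} = 0"
    by (simp add: zero_bmonom_def)
  then show ?thesis
    using reduce_single[of 0 1] by simp
qed

lemma reduce_indet: "reduce (indet i) = X i"
  by (simp add: indet_def reduce_single X_def)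

lemma X_square: "X i * X i = X i"
  using bmonom_Un[of "{i}" "{i}"] by (simp add: X_def mult_single)

lemma polynomials_single:
  "Poly_Mapping.keys u \<subseteq> {1..n} \<Longrightarrow> Poly_Mapping.single u c \<in> polynomials n"
  by (auto simp: polynomials_def)

lemma polynomials_add: "p \<in> polynomials n \<Longrightarrow> q \<in> polynomials n \<Longrightarrow> p + q \<in> polynomials n"
  using keys_add[of p q] by (fastforce simp: polynomials_def)

lemma field_ideal_add:
  assumes "p \<in> field_ideal n" "q \<in> field_ideal n"
  shows "p + q \<in> field_ideal n"
proof -
  from assms obtain c d where
    "\<forall>i. c i \<in> polynomials n" "p = (\<Sum>i = 1..n. c i * (indet i ^ 2 + indet i))"
    "\<forall>i. d i \<in> polynomials n" "q = (\<Sum>i = 1..n. d i * (indet i ^ 2 + indet i))"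
    unfolding field_ideal_def by blast
  then show ?thesis
    unfolding field_ideal_def
    by (intro CollectI exI[of _ "\<lambda>i. c i + d i"])
      (auto simp: polynomials_add sum.distrib distrib_right)
qed

lemma field_ideal_gen:
  assumes "i \<in> {1..n}" "p \<in> polynomials n"
  shows "p * (indet i ^ 2 + indet i) \<in> field_ideal n"
proof -
  let ?c = "\<lambda>k. if k = i then p else 0"
  have "(\<Sum>k = 1..n. ?c k * (indet k ^ 2 + indet k)) = p * (indet i ^ 2 + indet i)"
    using assms(1) by (simp add: if_distrib[of "\<lambda>c. c * _"] cong: if_cong)
  moreover have "\<forall>k. ?c k \<in> polynomials n"
    using assms(2) by (auto simp: polynomials_def)
  ultimately show ?thesis
    unfolding field_ideal_def by (intro CollectI exI[of _ ?c] conjI) (simp_all only: simp_thms)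
qed

lemma field_ideal_0: "0 \<in> field_ideal n"
  unfolding field_ideal_def
  by (intro CollectI exI[of _ "\<lambda>_. 0"]) (auto simp: polynomials_def)

lemma field_ideal_sum: "(\<And>i. i \<in> A \<Longrightarrow> g i \<in> field_ideal n) \<Longrightarrow> (\<Sum>i \<in> A. g i) \<in> field_ideal n"
  by (induction A rule: infinite_finite_induct) (auto simp: field_ideal_0 field_ideal_add)

definition squarefree_exp :: "nat set \<Rightarrow> (nat \<Rightarrow>\<^sub>0 nat)" where
  "squarefree_exp A = (\<Sum>i \<in> A. Poly_Mapping.single i 1)"

lemma lookup_squarefree_exp:
  "finite A \<Longrightarrow> Poly_Mapping.lookup (squarefree_exp A) k = (if k \<in> A then 1 else 0)"
  by (simp add: squarefree_exp_def lookup_sum lookup_single when_def)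

lemma keys_squarefree_exp: "finite A \<Longrightarrow> Poly_Mapping.keys (squarefree_exp A) = A"
  by (auto simp: in_keys_iff lookup_squarefree_exp split: if_splits)

lemma monomial_cong:
  assumes "Poly_Mapping.keys u \<subseteq> {1..n}"
  shows "Poly_Mapping.single u c + Poly_Mapping.single (squarefree_exp (Poly_Mapping.keys u)) c
    \<in> field_ideal n"
  using assms
proof (induction "\<Sum>i = 1..n. Poly_Mapping.lookup u i" arbitrary: u rule: less_induct)
  case less
  show ?case
  proof (cases "\<exists>i. Poly_Mapping.lookup u i \<ge> 2")
    case False
    then have "Poly_Mapping.lookup u k = (if k \<in> Poly_Mapping.keys u then 1 else 0)" for k
      by (metis One_nat_def in_keys_iff less_2_cases linorder_not_le)
    then have "u = squarefree_exp (Poly_Mapping.keys u)"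
      by (intro poly_mapping_eqI) (simp add: lookup_squarefree_exp)
    then have "Poly_Mapping.single u c + Poly_Mapping.single (squarefree_exp (Poly_Mapping.keys u)) c = 0"
      by (metis char2)
    then show ?thesis
      by (simp add: field_ideal_0)
  next
    case True
    then obtain i where i: "Poly_Mapping.lookup u i \<ge> 2"
      by blast
    define v where "v = u - Poly_Mapping.single i 2"
    define w where "w = v + Poly_Mapping.single i 1"
    have u: "u = v + Poly_Mapping.single i 2"
      using i by (intro poly_mapping_eqI)
        (auto simp: v_def lookup_add lookup_minus lookup_single when_def)
    have i_keys: "i \<in> Poly_Mapping.keys u"
      using i by (auto simp: in_keys_iff)
    then have i_n: "i \<in> {1..n}"
      using less.prems by blast
    have keys_w: "Poly_Mapping.keys w = Poly_Mapping.keys u"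
      by (simp add: u w_def keys_add_nat)
    have "Poly_Mapping.keys v \<subseteq> {1..n}"
      using less.prems by (simp add: u keys_add_nat)
    have "(\<Sum>k = 1..n. Poly_Mapping.lookup w k) < (\<Sum>k = 1..n. Poly_Mapping.lookup u k)"
      using i_n by (intro sum_strict_mono_ex1)
        (auto simp: u w_def lookup_add lookup_single when_def)
    then have w: "Poly_Mapping.single w c + Poly_Mapping.single (squarefree_exp (Poly_Mapping.keys u)) c
        \<in> field_ideal n"
      using less.hyps[of w] less.prems by (simp add: keys_w)
    have "Poly_Mapping.single u c + Poly_Mapping.single w c
        = Poly_Mapping.single v c * (indet i ^ 2 + indet i)"
      by (simp add: u w_def indet_def power2_eq_square mult_single distrib_left flip: single_add)
        (simp add: numeral_2_eq_2)
    also have "\<dots> \<in> field_ideal n"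
      using i_n \<open>Poly_Mapping.keys v \<subseteq> {1..n}\<close> by (intro field_ideal_gen polynomials_single)
    finally have "(Poly_Mapping.single u c + Poly_Mapping.single w c)
        + (Poly_Mapping.single w c + Poly_Mapping.single (squarefree_exp (Poly_Mapping.keys u)) c)
        \<in> field_ideal n"
      using w by (rule field_ideal_add)
    also have "(Poly_Mapping.single u c + Poly_Mapping.single w c)
        + (Poly_Mapping.single w c + Poly_Mapping.single (squarefree_exp (Poly_Mapping.keys u)) c)
        = Poly_Mapping.single u c + (Poly_Mapping.single w c + Poly_Mapping.single w c)
          + Poly_Mapping.single (squarefree_exp (Poly_Mapping.keys u)) c"
      by (simp only: add.assoc)
    finally show ?thesis
      by simp
  qed
qed

theorem reduce_kernel:
  assumes "p \<in> polynomials n"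
  shows "reduce p = 0 \<longleftrightarrow> p \<in> field_ideal n"
proof
  assume "p \<in> field_ideal n"
  then obtain c where p: "p = (\<Sum>i = 1..n. c i * (indet i ^ 2 + indet i))"
    unfolding field_ideal_def by blast
  have "reduce p = (\<Sum>i = 1..n. reduce (c i * (indet i ^ 2 + indet i)))"
    by (simp add: p reduce_eq_relabel relabel_sum)
  also have "\<dots> = 0"
    by (simp add: reduce_mult reduce_add reduce_indet power2_eq_square X_square)
  finally show "reduce p = 0" .
next
  assume red: "reduce p = 0"
  let ?sq = "\<lambda>u. squarefree_exp (Poly_Mapping.keys u)"
  have "relabel ?sq p = relabel (\<lambda>u. squarefree_exp (vars_of u)) (reduce p)"
    by (simp add: reduce_eq_relabel relabel_relabel bmonom_inverse)
  then have "p = relabel (\<lambda>u. u) p + relabel ?sq p"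
    by (simp add: red relabel_id)
  also have "\<dots> = (\<Sum>u \<in> Poly_Mapping.keys p. Poly_Mapping.single u (Poly_Mapping.lookup p u)
      + Poly_Mapping.single (?sq u) (Poly_Mapping.lookup p u))"
    by (simp add: relabel_def sum.distrib)
  also have "\<dots> \<in> field_ideal n"
    using assms by (intro field_ideal_sum monomial_cong) (auto simp: polynomials_def)
  finally show "p \<in> field_ideal n" .
qed

lemma keys_relabel: "Poly_Mapping.keys (relabel f p) \<subseteq> f ` Poly_Mapping.keys p"
proof
  fix k assume k: "k \<in> Poly_Mapping.keys (relabel f p)"
  then have "(\<Sum>u \<in> Poly_Mapping.keys p. (Poly_Mapping.lookup p u when f u = k)) \<noteq> 0"
    by (simp add: relabel_def in_keys_iff lookup_sum lookup_single del: bit_not_zero_iff)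
  then obtain u where "u \<in> Poly_Mapping.keys p" "(Poly_Mapping.lookup p u when f u = k) \<noteq> 0"
    by (meson sum.neutral)
  then show "k \<in> f ` Poly_Mapping.keys p"
    by (auto simp: when_def split: if_splits)
qed

theorem reduce_image: "reduce ` polynomials n = BP 1 n"
proof (intro equalityI subsetI)
  fix q assume "q \<in> reduce ` polynomials n"
  then obtain p where "q = reduce p" "p \<in> polynomials n"
    by blast
  then show "q \<in> BP 1 n"
    using keys_relabel[of "\<lambda>u. bmonom (Poly_Mapping.keys u)" p]
    by (force simp: BP_def vars_def reduce_eq_relabel polynomials_def bmonom_inverse)
next
  fix q assume q: "q \<in> BP 1 n"
  let ?p = "relabel (\<lambda>u. squarefree_exp (vars_of u)) q"
  have fin: "finite (vars_of u)" for u
    using vars_of by auto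
  have "reduce ?p = q"
    by (simp add: reduce_eq_relabel relabel_relabel keys_squarefree_exp fin vars_of_inverse relabel_id)
  moreover have "?p \<in> polynomials n"
    using q keys_relabel[of "\<lambda>u. squarefree_exp (vars_of u)" q]
    by (fastforce simp: polynomials_def BP_def vars_def keys_squarefree_exp fin)
  ultimately show "q \<in> reduce ` polynomials n"
    by (metis image_eqI)
qed

section \<open>Operations on Boolean polynomials\<close>

lemma UNIV_bit: "UNIV = {0, 1 :: bit}"
  by (auto intro: bit.exhaust)

definition subst :: "nat \<Rightarrow> bit \<Rightarrow> bpoly \<Rightarrow> bpoly" where
  "subst i \<alpha> p = (\<Sum>u \<in> Poly_Mapping.keys p.
     Const (Poly_Mapping.lookup p u) * (\<Prod>k \<in> vars_of u. if k = i then Const \<alpha> else X k))"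

definition bor :: "bpoly \<Rightarrow> bpoly \<Rightarrow> bpoly" where
  "bor p q = (p + 1) * (q + 1) + 1"

definition \<pi>min :: "nat \<Rightarrow> bpoly \<Rightarrow> nat" where
  "\<pi>min n p = (if vars p = {} then n + 1 else Min (vars p))"

definition F :: "bpoly set \<Rightarrow> bpoly" where
  "F P = (\<Prod>p \<in> P. p + 1) + 1"

definition \<N> :: "bpoly set \<Rightarrow> bpoly set" where
  "\<N> P = (if 1 \<in> P then {1} else P - {0})"

section \<open>Clauses and systems\<close>

definition literals :: "nat \<Rightarrow> bpoly set" where
  "literals n = {X i | i. i \<in> {1..n}} \<union> {X i + 1 | i. i \<in> {1..n}}"

definition CL :: "nat \<Rightarrow> bpoly set" where
  "CL n = {0, 1} \<union> {prod_list ls | ls. ls \<noteq> [] \<and> set ls \<subseteq> literals n \<and>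
     (\<forall>a < length ls. \<forall>b < length ls. a \<noteq> b \<longrightarrow> ls ! a \<notin> {ls ! b, ls ! b + 1})}"

definition CL_sum :: "nat \<Rightarrow> nat \<Rightarrow> bpoly set" where
  "CL_sum n l = {sum_list cs | cs. length cs = l \<and> set cs \<subseteq> CL n}"

text \<open>A system \<open>S(p\<^sub>1, \<dots>, p\<^sub>m)\<close> is given by the list of its left-hand sides.\<close>

definition Sat :: "nat \<Rightarrow> nat \<Rightarrow> bpoly list set" where
  "Sat n l = {ps. set ps \<subseteq> CL_sum n l}"

section \<open>The families of sets of polynomials\<close>

definition P_empty :: "nat \<Rightarrow> bpoly list \<Rightarrow> nat \<Rightarrow> bpoly set" where
  "P_empty n ps j = {p \<in> \<N> (set ps). \<pi>min n p = j}"

text \<open>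
  A family is a partial function on indices: the superscript
  \<open>\<alpha>\<^sub>i \<dots> \<alpha>\<^sub>j\<^sub>-\<^sub>1\<close> is the index \<open>(i, [\<alpha>\<^sub>i, \<dots>, \<alpha>\<^sub>j\<^sub>-\<^sub>1])\<close>, and the number of members of
  the family is the cardinality of the domain.  \<open>P_member n ps j P (i, \<alpha>s)\<close> reads off a member of
  the \<open>j\<close>-th family \<open>P\<close>; with \<open>i = j\<close> the tuple is empty and the set with
  superscript \<open>\<emptyset>\<close> is meant, which does not belong to the family.
\<close>

type_synonym index = "nat \<times> bit list"

definition P_member ::
  "nat \<Rightarrow> bpoly list \<Rightarrow> nat \<Rightarrow> (index \<rightharpoonup> bpoly set) \<Rightarrow> index \<Rightarrow> bpoly set" where
  "P_member n ps j P = (\<lambda>(i, \<alpha>s). if i = j then P_empty n ps j else the (P (i, \<alpha>s)))"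

fun P_family :: "nat \<Rightarrow> bpoly list \<Rightarrow> nat \<Rightarrow> (index \<rightharpoonup> bpoly set)" where
  "P_family n ps 0 = Map.empty" (* outside the range of j *)
| "P_family n ps (Suc 0) = Map.empty"
| "P_family n ps (Suc (Suc k)) = (let j = Suc (Suc k) in
     (\<lambda>(i, \<alpha>s).
        if 1 \<le> i \<and> i \<le> j - 1 \<and> length \<alpha>s = j - i
        then Some (\<N> (subst (j - 1) (last \<alpha>s) `
               P_member n ps (j - 1) (P_family n ps (j - 1)) (i, butlast \<alpha>s)))
        else None))"

abbreviation P_set :: "nat \<Rightarrow> bpoly list \<Rightarrow> nat \<Rightarrow> nat \<Rightarrow> bit list \<Rightarrow> bpoly set" where
  "P_set n ps j i \<alpha>s \<equiv> P_member n ps j (P_family n ps j) (i, \<alpha>s)"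

fun P_poly :: "bpoly list \<Rightarrow> nat \<Rightarrow> bpoly" where
  "P_poly ps 0 = 0" (* outside the range of j *)
| "P_poly ps (Suc 0) = foldr bor ps 0"
| "P_poly ps (Suc (Suc k)) = (\<Prod>\<alpha> \<in> UNIV. subst (Suc k) \<alpha> (P_poly ps (Suc k)))"

text \<open>
  \<open>nested n ps j k \<beta>\<close> with \<open>\<beta> = [\<alpha>\<^sub>k\<^sub>+\<^sub>1, \<dots>, \<alpha>\<^sub>j\<^sub>-\<^sub>1]\<close> is the part of the formula in the scope of
  the conjunctions over \<open>\<alpha>\<^sub>k\<^sub>+\<^sub>1, \<dots>, \<alpha>\<^sub>j\<^sub>-\<^sub>1\<close>: it is \<open>F(P\<^sub>j\<^sup>\<beta>)\<close> for \<open>k = 0\<close>, and otherwise the disjunction of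
  \<open>F(P\<^sub>j\<^sup>\<beta>)\<close> and the conjunction over \<open>\<alpha>\<^sub>k\<close>.
\<close>

fun nested :: "nat \<Rightarrow> bpoly list \<Rightarrow> nat \<Rightarrow> nat \<Rightarrow> bit list \<Rightarrow> bpoly" where
  "nested n ps j 0 \<beta> = F (P_set n ps j 1 \<beta>)"
| "nested n ps j (Suc k) \<beta> =
     bor (\<Prod>\<alpha> \<in> UNIV. nested n ps j k (\<alpha> # \<beta>)) (F (P_set n ps j (Suc (Suc k)) \<beta>))"

definition formula :: "nat \<Rightarrow> bpoly list \<Rightarrow> nat \<Rightarrow> bpoly" where
  "formula n ps j =
     (case j - 1 of
        0 \<Rightarrow> F (\<Union>k \<in> {j..n + 1}. P_empty n ps k)
      | Suc k \<Rightarrow> bor (\<Prod>\<alpha> \<in> UNIV. nested n ps j k [\<alpha>]) (F (\<Union>k \<in> {j..n + 1}. P_empty n ps k)))"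

section \<open>Computing time\<close>

text \<open>
  A clause is stored as a hash set of symbols: the empty set for the clause \<open>0\<close>, the set
  consisting of \<open>One\<close> for the clause \<open>1\<close>, and the set of its literals otherwise.  A polynomial in
  \<open>CL_sum n l\<close> is stored as the list of its \<open>l\<close> summands.
\<close>

datatype symbol = One | Pos nat | Neg nat

type_synonym stored_clause = "symbol set"
type_synonym stored_poly = "stored_clause list"

fun symbol_val :: "symbol \<Rightarrow> bpoly" where
  "symbol_val One = 1"
| "symbol_val (Pos i) = X i"
| "symbol_val (Neg i) = X i + 1"

definition clause_val :: "stored_clause \<Rightarrow> bpoly" where
  "clause_val A = (if A = {} then 0 else (\<Prod>s \<in> A. symbol_val s))"

definition poly_val :: "stored_poly \<Rightarrow> bpoly" where
  "poly_val q = (\<Sum>A \<leftarrow> q. clause_val A)"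

definition is_stored_clause :: "nat \<Rightarrow> stored_clause \<Rightarrow> bool" where
  "is_stored_clause n A \<longleftrightarrow> A = {One} \<or>
     (A \<subseteq> Pos ` {1..n} \<union> Neg ` {1..n} \<and> (\<forall>i. \<not> (Pos i \<in> A \<and> Neg i \<in> A)))"

definition is_stored_poly :: "nat \<Rightarrow> nat \<Rightarrow> stored_poly \<Rightarrow> bool" where
  "is_stored_poly n l q \<longleftrightarrow> length q = l \<and> (\<forall>A \<in> set q. is_stored_clause n A)"

text \<open>
  A set of polynomials is a hash set of stored polynomials, one for each polynomial in the set,
  here modelled as a list without repetitions of values.
\<close>

definition stores :: "nat \<Rightarrow> nat \<Rightarrow> stored_poly list \<Rightarrow> bpoly set \<Rightarrow> bool" where
  "stores n l Q P \<longleftrightarrow>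
     (\<forall>q \<in> set Q. is_stored_poly n l q) \<and> distinct (map poly_val Q) \<and> poly_val ` set Q = P"

text \<open>Timed programs: the state is a step counter.\<close>

type_synonym 'a timed = "(nat, 'a) state"

definition step :: "'a \<Rightarrow> 'a timed" where
  "step a = State (\<lambda>t. (a, t + 1))"

definition result :: "'a timed \<Rightarrow> 'a" where
  "result c = fst (run_state c 0)"

definition time :: "'a timed \<Rightarrow> nat" where
  "time c = snd (run_state c 0)"

text \<open>Substitution of \<open>\<alpha>\<close> for \<open>x\<^sub>i\<close>: search for the literal that becomes \<open>0\<close>, then for the one
  that becomes \<open>1\<close>, which is deleted.\<close>

definition subst_clause :: "nat \<Rightarrow> bit \<Rightarrow> stored_clause \<Rightarrow> stored_clause timed" where
  "subst_clause i \<alpha> A =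
     (let s0 = (if \<alpha> = 0 then Pos i else Neg i); s1 = (if \<alpha> = 0 then Neg i else Pos i) in do {
        b0 \<leftarrow> step (s0 \<in> A);
        if b0 then step {}
        else do {
          b1 \<leftarrow> step (s1 \<in> A);
          if b1 then do {
            A' \<leftarrow> step (A - {s1});
            e \<leftarrow> step (A' = {});
            if e then step {One} else State_Monad.return A'
          }
          else State_Monad.return A
        }
      })"

definition subst_poly :: "nat \<Rightarrow> bit \<Rightarrow> stored_poly \<Rightarrow> stored_poly timed" where
  "subst_poly i \<alpha> q = State_Monad.traverse_list (subst_clause i \<alpha>) q"

text \<open>
  Hash sets of polynomials are addressed by the polynomial, not by its storage: insertion and, in
  \<open>norm_set\<close>, the search for \<open>1\<close> and the deletion of \<open>0\<close> are single steps.
\<close>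

definition insert_poly :: "stored_poly \<Rightarrow> stored_poly list \<Rightarrow> stored_poly list timed" where
  "insert_poly q Q = step (if poly_val q \<in> poly_val ` set Q then Q else q # Q)"

fun subst_set :: "nat \<Rightarrow> bit \<Rightarrow> stored_poly list \<Rightarrow> stored_poly list timed" where
  "subst_set i \<alpha> [] = State_Monad.return []"
| "subst_set i \<alpha> (q # Q) = do {
     q' \<leftarrow> subst_poly i \<alpha> q;
     Q' \<leftarrow> subst_set i \<alpha> Q;
     insert_poly q' Q'
   }"

definition norm_set :: "stored_poly list \<Rightarrow> stored_poly list timed" where
  "norm_set Q = do {
     b \<leftarrow> step (1 \<in> poly_val ` set Q);
     if b then step (filter (\<lambda>q. poly_val q = 1) Q)
     else step (filter (\<lambda>q. poly_val q \<noteq> 0) Q)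
   }"

text \<open>
  One instance of the recursion formula.  No step is charged for an empty set: only the nonempty
  members of a family are stored and processed.  With a positive charge for every empty set the
  time bound of the theorem, which counts polynomials and not sets, would fail: for the system
  with the single polynomial \<open>x\<^sub>1 \<cdots> x\<^sub>n\<close> and \<open>2 \<le> j \<le> n\<close>, exactly one of the sets in stage
  \<open>j - 1\<close> is nonempty and it has one element, whereas the \<open>j\<close>-th family has \<open>2\<^sup>j - 2\<close> members.
\<close>

definition next_set :: "nat \<Rightarrow> bit \<Rightarrow> stored_poly list \<Rightarrow> stored_poly list timed" where
  "next_set i \<alpha> Q =
     (if Q = [] then State_Monad.return []
      else do { Q' \<leftarrow> subst_set i \<alpha> Q; norm_set Q' })"

text \<open>
  \<open>stores_family n l ps j R\<close>: \<open>R\<close> gives stored versions of all sets of stage \<open>j\<close>, the one with the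
  empty superscript included.  The members of the next family are computed from them, each by one
  run of \<open>next_set\<close>.
\<close>

definition stores_family ::
  "nat \<Rightarrow> nat \<Rightarrow> bpoly list \<Rightarrow> nat \<Rightarrow> (index \<Rightarrow> stored_poly list) \<Rightarrow> bool" where
  "stores_family n l ps j R \<longleftrightarrow>
     (\<forall>i \<in> {1..j}. \<forall>\<alpha>s. length \<alpha>s = j - i \<longrightarrow> stores n l (R (i, \<alpha>s)) (P_set n ps j i \<alpha>s))"

definition next_member :: "nat \<Rightarrow> (index \<Rightarrow> stored_poly list) \<Rightarrow> index \<Rightarrow> stored_poly list timed" where
  "next_member j R = (\<lambda>(i, \<alpha>s). next_set (j - 1) (last \<alpha>s) (R (i, butlast \<alpha>s)))"

definition family_time :: "nat \<Rightarrow> bpoly list \<Rightarrow> nat \<Rightarrow> (index \<Rightarrow> stored_poly list) \<Rightarrow> nat" where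
  "family_time n ps j R = (\<Sum>ix \<in> dom (P_family n ps j). time (next_member j R ix))"

end

theory Submission
  imports Defs
begin

text \<open>
  Boolean polynomials are idempotent, so the product over a finite set commutes with images:
  \<open>F\<close> is unchanged when polynomials collapse under a substitution, and also under \<open>\<N>\<close>.  Hence
  substituting \<open>\<alpha>\<close> for \<open>x\<^sub>j\<close> in the formula for \<open>P\<^sub>j\<close> appends \<open>\<alpha>\<close> to all superscripts and leaves
  the part with \<open>\<pi>\<^sub>m\<^sub>i\<^sub>n > j\<close> alone; this part is pulled out of the product over
  \<open>\<alpha>\<close> because \<open>\<or>\<close> distributes over \<open>\<and>\<close>.  For the time bound, a clause costs at most five steps and
  each set of stage \<open>j - 1\<close> is used for two sets of stage \<open>j\<close>.
\<close>


section \<open>Monomials, constants and idempotence\<close>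

lemma finite_vars_of [simp]: "finite (vars_of u)"
  using vars_of by auto

lemma vars_of_plus: "vars_of (u + v) = vars_of u \<union> vars_of v"
  by transfer simp

lemma vars_of_zero [simp]: "vars_of 0 = {}"
  by transfer simp

lemma bmonom_add_idem [simp]: "u + u = (u :: bmonom)"
  by transfer simp

lemma Const_0 [simp]: "Const 0 = 0"
  by (simp add: Const_def)

lemma Const_1 [simp]: "Const 1 = 1"
  by (simp add: Const_def)

lemma Const_add: "Const (a + b) = Const a + Const b"
  by (simp add: Const_def single_add del: add_bit_eq_xor)

lemma Const_mult: "Const (a * b) = Const a * Const b"
  by (simp add: Const_def mult_single)

text \<open>A polynomial is the finite sum of its terms, so identities that are additive in
  \<open>p\<close> reduce to monomials. Zero is covered by \<open>single\<close> with coefficient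
  0.\<close>

lemma bpoly_induct [case_names single add]:
  assumes single: "\<And>u c. P (Poly_Mapping.single u c)" and add: "\<And>p q. P p \<Longrightarrow> P q \<Longrightarrow> P (p + q)"
  shows "P (p :: 'a \<Rightarrow>\<^sub>0 bit)"
proof -
  have "P (\<Sum>u \<in> A. Poly_Mapping.single u (Poly_Mapping.lookup p u))" for A
    by (induction A rule: infinite_finite_induct) (use single[of _ 0] single add in auto)
  then show ?thesis
    using relabel_id[of p] unfolding relabel_def by metis
qed

lemma bit_idem [simp]: "c * c = (c :: bit)"
  by (cases c) auto

text \<open>Squaring is additive in characteristic 2, because the cross terms cancel, and monomials
  are idempotent under union.\<close>

lemma bpoly_idem [simp]: "p * p = (p :: bpoly)"
proof (induction p rule: bpoly_induct)
  case (single u c)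
  show ?case by (simp add: mult_single del: mult_bit_eq_and)
next
  case (add p q)
  have "(p + q) * (p + q) = p * p + q * q + (p * q + p * q)"
    by (simp only: distrib_left distrib_right ac_simps)
  then show ?case
    using add by simp
qed

lemma bpoly_idem_left [simp]: "p * (p * q) = p * (q :: bpoly)"
  by (simp flip: mult.assoc)

section \<open>Substitution is a ring homomorphism\<close>

definition subst_monom :: "nat \<Rightarrow> bit \<Rightarrow> bmonom \<Rightarrow> bpoly" where
  "subst_monom i \<alpha> u = (\<Prod>k \<in> vars_of u. if k = i then Const \<alpha> else X k)"

lemma prod_idem_insert:
  fixes f :: "'b \<Rightarrow> bpoly"
  assumes "finite A"
  shows "(\<Prod>k \<in> insert a A. f k) = f a * (\<Prod>k \<in> A. f k)"
proof (cases "a \<in> A")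
  case True
  then show ?thesis
    using prod.remove[OF assms True, of f] by (simp add: insert_absorb)
qed (use assms in auto)

lemma prod_idem_Un:
  fixes f :: "'b \<Rightarrow> bpoly"
  assumes "finite A" "finite B"
  shows "(\<Prod>k \<in> A \<union> B. f k) = (\<Prod>k \<in> A. f k) * (\<Prod>k \<in> B. f k)"
  using assms by (induction A rule: finite_induct) (simp_all add: prod_idem_insert mult.assoc)

text \<open>Collisions of \<open>g\<close> merely repeat factors, and idempotence absorbs
  repetitions. This is what handles polynomials that become equal under a substitution.\<close>

lemma prod_idem_image:
  fixes f :: "'b \<Rightarrow> bpoly"
  assumes "finite A"
  shows "(\<Prod>k \<in> g ` A. f k) = (\<Prod>k \<in> A. f (g k))"
  using assms by (induction A rule: finite_induct) (simp_all add: prod_idem_insert)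

text \<open>Enlarging the index set adds only terms with coefficient 0; two polynomials with
  different supports can then be compared termwise.\<close>

lemma subst_superset:
  assumes "finite A" "Poly_Mapping.keys p \<subseteq> A"
  shows "subst i \<alpha> p = (\<Sum>u \<in> A. Const (Poly_Mapping.lookup p u) * subst_monom i \<alpha> u)"
  unfolding subst_def subst_monom_def using assms
  by (intro sum.mono_neutral_left) (auto simp: in_keys_iff simp del: bit_not_zero_iff)

lemma subst_add: "subst i \<alpha> (p + q) = subst i \<alpha> p + subst i \<alpha> q"
proof -
  let ?A = "Poly_Mapping.keys p \<union> Poly_Mapping.keys q"
  have "subst i \<alpha> r = (\<Sum>u \<in> ?A. Const (Poly_Mapping.lookup r u) * subst_monom i \<alpha> u)"
    if "Poly_Mapping.keys r \<subseteq> ?A" for r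
    using that by (intro subst_superset) auto
  then show ?thesis
    using keys_add[of p q]
    by (simp only: lookup_add Const_add distrib_right sum.distrib Un_upper1 Un_upper2)
qed

lemma subst_single: "subst i \<alpha> (Poly_Mapping.single u c) = Const c * subst_monom i \<alpha> u"
  by (subst subst_superset[of "{u}"]) auto

lemma subst_monom_plus: "subst_monom i \<alpha> (u + v) = subst_monom i \<alpha> u * subst_monom i \<alpha> v"
  by (simp add: subst_monom_def vars_of_plus prod_idem_Un)

text \<open>Both sides are additive in \<open>p\<close> and in \<open>q\<close>, so only products of
  monomials matter. There a variable common to both factors does no harm, by idempotence.\<close>

lemma subst_mult: "subst i \<alpha> (p * q) = subst i \<alpha> p * subst i \<alpha> q"
proof (induction p rule: bpoly_induct)
  case (single u c)
  show ?case
    by (induction q rule: bpoly_induct)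
      (simp_all add: mult_single subst_single subst_monom_plus Const_mult subst_add distrib_left
        distrib_right mult_ac del: mult_bit_eq_and)
qed (simp add: distrib_right subst_add)

lemma subst_Const [simp]: "subst i \<alpha> (Const c) = Const c"
  by (simp add: Const_def subst_single subst_monom_def mult_single)

lemma subst_0 [simp]: "subst i \<alpha> 0 = 0"
  using subst_Const[of i \<alpha> 0] by simp

lemma subst_1 [simp]: "subst i \<alpha> 1 = 1"
  using subst_Const[of i \<alpha> 1] by simp

lemma vars_of_bmonom_singleton: "vars_of (bmonom {k}) = {k}"
  by (simp add: bmonom_inverse)

lemma subst_X: "subst i \<alpha> (X k) = (if k = i then Const \<alpha> else X k)"
  by (simp add: X_def subst_single subst_monom_def vars_of_bmonom_singleton)

lemma subst_prod: "subst i \<alpha> (\<Prod>k \<in> A. f k) = (\<Prod>k \<in> A. subst i \<alpha> (f k))"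
  by (induction A rule: infinite_finite_induct) (simp_all add: subst_mult)

lemma prod_X: "(\<Prod>k \<in> vars_of u. X k) = Poly_Mapping.single u 1"
proof -
  have "finite A \<Longrightarrow> (\<Prod>k \<in> A. X k) = Poly_Mapping.single (bmonom A) 1" for A
  proof (induction A rule: finite_induct)
    case empty
    then show ?case
      by (metis prod.empty single_one zero_bmonom_def)
  next
    case (insert a A)
    then show ?case
      using bmonom_Un[of "{a}" A] by (simp add: X_def mult_single)
  qed
  from this[OF finite_vars_of] show ?thesis
    by (simp add: vars_of_inverse)
qed

lemma subst_not_in_vars:
  assumes "i \<notin> vars p"
  shows "subst i \<alpha> p = p"
proof -
  have "subst_monom i \<alpha> u = Poly_Mapping.single u 1" if "u \<in> Poly_Mapping.keys p" for u
  proof -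
    have "i \<notin> vars_of u"
      using that assms by (auto simp: vars_def)
    then show ?thesis
      unfolding subst_monom_def prod_X[symmetric] by (intro prod.cong) auto
  qed
  \<comment> \<open>Relabelling by the identity serves as the expansion of \<open>p\<close> into its
    terms.\<close>
  then have "subst i \<alpha> p = relabel (\<lambda>u. u) p"
    by (simp add: subst_def relabel_def Const_def mult_single flip: subst_monom_def del: mult_bit_eq_and)
  then show ?thesis
    by (simp add: relabel_id)
qed

section \<open>Variables of a Boolean polynomial\<close>

lemma finite_vars [simp]: "finite (vars p)"
  by (simp add: vars_def)

lemma vars_0 [simp]: "vars 0 = {}"
  by (simp add: vars_def)

lemma vars_1 [simp]: "vars 1 = {}"
  by (simp add: vars_def)

lemma vars_Const [simp]: "vars (Const c) = {}"
  by (simp add: vars_def Const_def)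

lemma vars_X [simp]: "vars (X k) = {k}"
  by (simp add: vars_def X_def vars_of_bmonom_singleton)

lemma vars_add: "vars (p + q) \<subseteq> vars p \<union> vars q"
  using keys_add[of p q] by (auto simp: vars_def)

lemma vars_mult: "vars (p * q) \<subseteq> vars p \<union> vars q"
proof
  fix k assume "k \<in> vars (p * q)"
  then obtain w where "w \<in> Poly_Mapping.keys (p * q)" "k \<in> vars_of w"
    by (auto simp: vars_def)
  then obtain u v where "u \<in> Poly_Mapping.keys p" "v \<in> Poly_Mapping.keys q" "k \<in> vars_of (u + v)"
    using keys_mult[of p q] by auto
  then show "k \<in> vars p \<union> vars q"
    by (auto simp: vars_def vars_of_plus)
qed

lemma vars_add_subsetI: "vars p \<subseteq> S \<Longrightarrow> vars q \<subseteq> S \<Longrightarrow> vars (p + q) \<subseteq> S"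
  using vars_add by blast

lemma vars_mult_subsetI: "vars p \<subseteq> S \<Longrightarrow> vars q \<subseteq> S \<Longrightarrow> vars (p * q) \<subseteq> S"
  using vars_mult by blast

lemma vars_sum_subsetI: "(\<And>a. a \<in> A \<Longrightarrow> vars (f a) \<subseteq> S) \<Longrightarrow> vars (\<Sum>a \<in> A. f a) \<subseteq> S"
  by (induction A rule: infinite_finite_induct) (simp_all add: vars_add_subsetI)

lemma vars_prod_subsetI: "(\<And>a. a \<in> A \<Longrightarrow> vars (f a) \<subseteq> S) \<Longrightarrow> vars (\<Prod>a \<in> A. f a) \<subseteq> S"
  by (induction A rule: infinite_finite_induct) (simp_all add: vars_mult_subsetI)

lemma vars_subst: "vars (subst i \<alpha> p) \<subseteq> vars p - {i}"
  unfolding subst_def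
  by (intro vars_sum_subsetI vars_mult_subsetI vars_prod_subsetI) (auto simp: vars_def[of p])

section \<open>Disjunctions\<close>

lemma bor_plus_1: "bor p q + 1 = (p + 1) * (q + 1)"
  by (simp add: bor_def add.assoc)

lemma F_plus_1: "F P + 1 = (\<Prod>p \<in> P. p + 1)"
  by (simp add: F_def add.assoc)

text \<open>Adding 1 is negation, and the negations of \<open>bor\<close> and \<open>F\<close> are
  plain products. Identities between disjunctions are therefore proved in negated form.\<close>

lemma bpoly_eqI: "p + 1 = q + 1 \<Longrightarrow> p = (q :: bpoly)"
  by simp

lemma subst_bor: "subst i \<alpha> (bor p q) = bor (subst i \<alpha> p) (subst i \<alpha> q)"
  by (simp add: bor_def subst_add subst_mult)

lemma subst_F: "finite P \<Longrightarrow> subst i \<alpha> (F P) = F (subst i \<alpha> ` P)"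
  by (simp add: F_def subst_add subst_prod prod_idem_image)

lemma F_Un: "finite P \<Longrightarrow> finite Q \<Longrightarrow> F (P \<union> Q) = bor (F P) (F Q)"
  by (rule bpoly_eqI) (simp only: F_plus_1 bor_plus_1 prod_idem_Un)

lemma F_empty: "F {} = 0"
  by (simp add: F_def)

text \<open>An element 1 contributes the factor 0 and makes the whole disjunction 1; an element 0
  contributes the factor 1.\<close>

lemma F_\<N>:
  assumes "finite P"
  shows "F (\<N> P) = F P"
proof (cases "1 \<in> P")
  case True
  then have "(\<Prod>p \<in> P. p + 1) = (0 :: bpoly)"
    using assms by (intro prod_zero bexI[of _ 1]) auto
  then show ?thesis
    using True by (simp add: \<N>_def F_def)
next
  case False
  then show ?thesis
    using assms by (simp add: \<N>_def F_def) (intro prod.mono_neutral_left, auto)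
qed

lemma bor_assoc: "bor (bor p q) r = bor p (bor q r)"
  by (rule bpoly_eqI) (simp only: bor_plus_1 mult.assoc)

lemma bor_mult_distrib: "bor (p * q) r = bor p r * bor q r"
proof -
  have bor: "bor p r = p * (r + 1) + r" for p
  proof -
    have "bor p r = p * (r + 1) + (r + (1 + 1))"
      unfolding bor_def by (simp only: distrib_right mult_1_left add.assoc)
    then show ?thesis
      by (simp only: char2 add_0_right)
  qed
  \<comment> \<open>This kills both mixed terms in the expansion below.\<close>
  have zero: "(r + 1) * r = 0"
    by (simp add: distrib_right)
  have "bor p r * bor q r = p * q * ((r + 1) * (r + 1)) + p * ((r + 1) * r) + q * ((r + 1) * r) + r * r"
    unfolding bor by (simp only: distrib_left distrib_right ac_simps)
  also have "\<dots> = bor (p * q) r"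
    unfolding zero by (simp add: bor)
  finally show ?thesis ..
qed

text \<open>Repeated entries of the list disappear because disjunction is idempotent.\<close>

lemma F_set: "foldr bor ps 0 = F (set ps)"
proof (induction ps)
  case (Cons p ps)
  have "bor p (F (set ps)) + 1 = F (set (p # ps)) + 1"
    by (simp only: F_plus_1 bor_plus_1 list.set prod_idem_insert finite_set)
  then have "bor p (F (set ps)) = F (set (p # ps))"
    by (rule bpoly_eqI)
  with Cons show ?case
    by simp
qed (simp add: F_empty)

lemma prod_bit: "(\<Prod>\<alpha> \<in> (UNIV :: bit set). f \<alpha>) = f 0 * (f 1 :: bpoly)"
  by (simp add: UNIV_bit)

section \<open>The families\<close>

lemma finite_\<N>: "finite P \<Longrightarrow> finite (\<N> P)"
  by (simp add: \<N>_def)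

lemma card_\<N>:
  assumes "finite P"
  shows "card (\<N> P) \<le> card P"
proof (cases "1 \<in> P")
  case True
  then show ?thesis
    using assms by (simp add: \<N>_def Suc_le_eq card_gt_0_iff) blast
next
  case False
  then show ?thesis
    using assms by (simp add: \<N>_def card_mono)
qed

lemma \<N>_subset: "\<N> P \<subseteq> P"
  by (simp add: \<N>_def)

lemma P_family_Suc:
  assumes "1 \<le> j" "1 \<le> i" "i \<le> j" "length \<alpha>s = Suc j - i"
  shows "P_family n ps (Suc j) (i, \<alpha>s) = Some (\<N> (subst j (last \<alpha>s) ` P_set n ps j i (butlast \<alpha>s)))"
  using assms by (cases j) auto

lemma P_set_Suc:
  assumes "1 \<le> j" "1 \<le> i" "i \<le> j" "length \<alpha>s = Suc j - i"
  shows "P_set n ps (Suc j) i \<alpha>s = \<N> (subst j (last \<alpha>s) ` P_set n ps j i (butlast \<alpha>s))"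
  using P_family_Suc[OF assms] assms by (simp add: P_member_def)

lemma P_set_diag: "P_set n ps j j \<alpha>s = P_empty n ps j"
  by (simp add: P_member_def)

lemma dom_P_family: "dom (P_family n ps j) = (SIGMA i:{1..j - 1}. {\<alpha>s. length \<alpha>s = j - i})"
  by (cases "(n, ps, j)" rule: P_family.cases) (auto simp: Let_def split: if_splits)

text \<open>Follows a single set through the stages: \<open>i\<close> is fixed, the start is the
  empty superscript at stage \<open>i\<close>, and each stage appends one bit. Finiteness,
  membership in \<open>BP\<close> and storability are all obtained this way.\<close>

lemma P_set_induct [consumes 3, case_names empty step]:
  assumes "1 \<le> i" "i \<le> j" "length \<alpha>s = j - i"
    and "Q i (P_empty n ps i)"
    and "\<And>k \<alpha> P. i \<le> k \<Longrightarrow> k < j \<Longrightarrow> Q k P \<Longrightarrow> Q (Suc k) (\<N> (subst k \<alpha> ` P))"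
  shows "Q j (P_set n ps j i \<alpha>s)"
  using assms(2-)
proof (induction j arbitrary: \<alpha>s rule: dec_induct)
  case base
  then show ?case by (simp add: P_set_diag)
next
  case (step m)
  have "Q m (P_set n ps m i (butlast \<alpha>s))"
    using step by auto
  then show ?case
    using step assms(1) by (subst P_set_Suc) auto
qed

lemma finite_P_empty: "finite (P_empty n ps j)"
  unfolding P_empty_def using finite_\<N>[of "set ps"] by simp

lemma finite_P_set:
  assumes "1 \<le> i" "i \<le> j" "length \<alpha>s = j - i"
  shows "finite (P_set n ps j i \<alpha>s)"
  using assms by (induction rule: P_set_induct) (simp_all add: finite_P_empty finite_\<N>)

section \<open>Counting superscripts and members\<close>

lemma bit_lists_length: "{\<alpha>s. length \<alpha>s = k} = {\<alpha>s. set \<alpha>s \<subseteq> (UNIV :: bit set) \<and> length \<alpha>s = k}"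
  by simp

lemma finite_bit_lists: "finite {\<alpha>s :: bit list. length \<alpha>s = k}"
  unfolding bit_lists_length by (rule finite_lists_length_eq) (simp add: UNIV_bit)

lemma card_bit_lists: "card {\<alpha>s :: bit list. length \<alpha>s = k} = 2 ^ k"
  unfolding bit_lists_length by (subst card_lists_length_eq) (simp_all add: UNIV_bit numeral_2_eq_2)

lemma sum_pow2: "(\<Sum>i = 1..j - 1. 2 ^ (j - i)) = (2 :: nat) ^ j - 2"
proof (cases j)
  case (Suc k)
  have "(\<Sum>i = 1..k. 2 ^ (Suc k - i)) = (2 :: nat) ^ Suc k - 2" for k
  proof (induction k)
    case (Suc k)
    have "(\<Sum>i = 1..k. 2 ^ (Suc (Suc k) - i)) = (\<Sum>i = 1..k. 2 * (2 :: nat) ^ (Suc k - i))"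
      by (intro sum.cong) (auto simp: Suc_diff_le)
    also have "\<dots> = 2 * (2 ^ Suc k - 2)"
      using Suc by (simp flip: sum_distrib_left)
    \<comment> \<open>Writing the power as a successor makes the truncated subtractions
      exact.\<close>
    moreover obtain m where "(2 :: nat) ^ k = Suc m"
      by (metis not0_implies_Suc power_not_zero zero_neq_numeral)
    ultimately show ?case
      by simp
  qed simp
  from this[of k] show ?thesis
    using Suc by simp
qed simp

lemma card_dom_P_family: "card (dom (P_family n ps j)) = 2 ^ j - 2"
  using sum_pow2[of j] unfolding dom_P_family
  by (simp add: card_SigmaI finite_bit_lists card_bit_lists)

lemma card_P_set_Suc_le:
  assumes "1 \<le> i" "i \<le> j" "length \<alpha>s = Suc j - i"
  shows "card (P_set n ps (Suc j) i \<alpha>s) \<le> card (P_set n ps j i (butlast \<alpha>s))"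
proof -
  have fin: "finite (P_set n ps j i (butlast \<alpha>s))"
    using assms by (intro finite_P_set) auto
  have "card (P_set n ps (Suc j) i \<alpha>s)
      = card (\<N> (subst j (last \<alpha>s) ` P_set n ps j i (butlast \<alpha>s)))"
    using assms by (subst P_set_Suc) auto
  also have "\<dots> \<le> card (subst j (last \<alpha>s) ` P_set n ps j i (butlast \<alpha>s))"
    using fin by (intro card_\<N>) simp
  also have "\<dots> \<le> card (P_set n ps j i (butlast \<alpha>s))"
    using fin by (rule card_image_le)
  finally show ?thesis .
qed

section \<open>The sets of a stage lie in \<open>BP j n\<close>\<close>

lemma vars_literal: "p \<in> literals n \<Longrightarrow> vars p \<subseteq> {1..n}"
  by (auto simp: literals_def dest!: subsetD[OF vars_add])

lemma vars_CL: 
  assumes "p \<in> CL n"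
  shows "vars p \<subseteq> {1..n}"
proof -
  have "vars (prod_list ls) \<subseteq> {1..n}" if "set ls \<subseteq> literals n" for ls
    using that by (induction ls) (auto dest!: subsetD[OF vars_mult] subsetD[OF vars_literal])
  then show ?thesis
    using assms by (auto simp: CL_def)
qed

lemma CL_sum_subset_BP: "CL_sum n l \<subseteq> BP 1 n"
proof -
  have "vars (sum_list cs) \<subseteq> {1..n}" if "set cs \<subseteq> CL n" for cs
    using that by (induction cs) (auto dest!: subsetD[OF vars_add] subsetD[OF vars_CL])
  then show ?thesis
    by (auto simp: CL_sum_def BP_def)
qed

lemma subst_BP: "p \<in> BP k n \<Longrightarrow> subst k \<alpha> p \<in> BP (Suc k) n"
  using vars_subst[of k \<alpha> p] by (force simp: BP_def)

text \<open>The minimal subscript bounds all variables from below; a constant has no variables and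
  lies in every \<open>BP j n\<close>.\<close>

lemma \<pi>min_BP: 
  assumes "set ps \<subseteq> BP 1 n" "p \<in> P_empty n ps j"
  shows "p \<in> BP j n"
proof -
  have "p \<in> set ps"
    using assms(2) \<N>_subset[of "set ps"] by (auto simp: P_empty_def)
  moreover have "\<forall>k \<in> vars p. j \<le> k"
    using assms(2) by (auto simp: P_empty_def \<pi>min_def)
  moreover have "vars p \<subseteq> {1..n}"
    using \<open>p \<in> set ps\<close> assms(1) by (auto simp: BP_def)
  ultimately show ?thesis
    by (auto simp: BP_def)
qed

lemma P_set_BP:
  assumes "set ps \<subseteq> BP 1 n" "1 \<le> i" "i \<le> j" "length \<alpha>s = j - i"
  shows "P_set n ps j i \<alpha>s \<subseteq> BP j n"
  using assms(2-)
proof (induction rule: P_set_induct)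
  case empty
  show ?case
    using \<pi>min_BP[OF assms(1)] by blast
next
  case (step k \<alpha> P)
  then show ?case
    using \<N>_subset subst_BP by blast
qed

section \<open>The formula\<close>

text \<open>Since \<open>F\<close> does not distinguish a finite set from its image under
  \<open>\<N>\<close>, the recursion for the sets becomes a mere substitution once \<open>F\<close>
  is applied.\<close>

lemma subst_F_P_set:
  assumes "1 \<le> i" "i \<le> j" "length \<beta> = j - i"
  shows "subst j \<alpha> (F (P_set n ps j i \<beta>)) = F (P_set n ps (Suc j) i (\<beta> @ [\<alpha>]))"
  using assms by (simp add: P_set_Suc finite_P_set subst_F F_\<N>)

text \<open>The conjunctions extend the superscript at the front and the substitution extends it at
  the back, so the two do not interfere.\<close>

lemma subst_nested:
  assumes "k < j" "length \<beta> = j - 1 - k"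
  shows "subst j \<alpha> (nested n ps j k \<beta>) = nested n ps (Suc j) k (\<beta> @ [\<alpha>])"
  using assms
proof (induction k arbitrary: \<beta>)
  case 0
  then show ?case
    by (simp add: subst_F_P_set)
next
  case (Suc k)
  have "subst j \<alpha> (nested n ps j k (\<gamma> # \<beta>)) = nested n ps (Suc j) k ((\<gamma> # \<beta>) @ [\<alpha>])" for \<gamma>
    using Suc.prems by (intro Suc.IH) auto
  moreover have "subst j \<alpha> (F (P_set n ps j (Suc (Suc k)) \<beta>))
      = F (P_set n ps (Suc j) (Suc (Suc k)) (\<beta> @ [\<alpha>]))"
    using Suc.prems by (intro subst_F_P_set) auto
  ultimately show ?case
    by (simp add: subst_bor subst_prod)
qed

text \<open>Moving \<open>P_empty n ps j\<close> from the final union into the nested part completes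
  one more level, with empty superscript. What remains outside is free of the variable to be
  substituted next.\<close>

lemma formula_eq_bor_nested:
  assumes "1 \<le> j" "j \<le> n"
  shows "formula n ps j = bor (nested n ps j (j - 1) []) (F (\<Union>k \<in> {Suc j..n + 1}. P_empty n ps k))"
proof -
  have "{j..n + 1} = insert j {Suc j..n + 1}"
    using assms by auto
  then have F: "F (\<Union>k \<in> {j..n + 1}. P_empty n ps k)
      = bor (F (P_empty n ps j)) (F (\<Union>k \<in> {Suc j..n + 1}. P_empty n ps k))"
    by (simp add: F_Un finite_P_empty)
  show ?thesis
  proof (cases "j - 1")
    case 0
    then have "j = 1"
      using assms by simp
    then show ?thesis
      using F by (simp add: formula_def P_member_def)
  next
    case (Suc k)
    then have "j = Suc (Suc k)"
      by simp
    then show ?thesis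
      using F by (simp add: formula_def P_member_def bor_assoc)
  qed
qed

lemma P_poly_eq_formula:
  assumes "set ps \<subseteq> BP 1 n" "1 \<le> j" "j \<le> n + 1"
  shows "P_poly ps j = formula n ps j"
  using assms(2,3)
proof (induction j rule: dec_induct)
  case base
  \<comment> \<open>Every polynomial falls into one of the classes, the constants into class
    \<open>n + 1\<close>, so at stage 1 the union is the entire set.\<close>
  have "\<pi>min n p \<in> {1..n + 1}" if "p \<in> \<N> (set ps)" for p
  proof (cases "vars p = {}")
    case False
    then have "Min (vars p) \<in> vars p"
      by simp
    also have "vars p \<subseteq> {1..n}"
      using that \<N>_subset assms(1) by (auto simp: BP_def)
    finally show ?thesis
      using False by (simp add: \<pi>min_def)
  qed (simp add: \<pi>min_def)
  then have "(\<Union>k \<in> {1..n + 1}. P_empty n ps k) = \<N> (set ps)"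
    unfolding P_empty_def by blast
  then show ?case
    by (simp add: formula_def F_set F_\<N>)
next
  case (step j)
  define R where "R = F (\<Union>k \<in> {Suc j..n + 1}. P_empty n ps k)"
  have rest: "subst j \<alpha> R = R" for \<alpha>
  proof -
    have "subst j \<alpha> p = p" if "p \<in> (\<Union>k \<in> {Suc j..n + 1}. P_empty n ps k)" for p
      using that \<pi>min_BP[OF assms(1)] by (intro subst_not_in_vars) (fastforce simp: BP_def)
    then show ?thesis
      by (simp add: R_def subst_F finite_P_empty)
  qed
  have formula: "formula n ps j = bor (nested n ps j (j - 1) []) R"
    unfolding R_def using step by (intro formula_eq_bor_nested) auto
  \<comment> \<open>Exposes the successor on which \<open>P_poly\<close> and \<open>nested\<close>
    recurse.\<close>
  have j: "j = Suc (j - 1)"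
    using step by simp
  have "P_poly ps (Suc j) = (\<Prod>\<alpha> \<in> UNIV. subst j \<alpha> (formula n ps j))"
    using step j P_poly.simps(3)[of ps "j - 1"] by simp
  also have "\<dots> = (\<Prod>\<alpha> \<in> UNIV. bor (nested n ps (Suc j) (j - 1) [\<alpha>]) R)"
    using step.hyps by (simp add: formula subst_bor rest subst_nested)
  also have "\<dots> = bor (\<Prod>\<alpha> \<in> UNIV. nested n ps (Suc j) (j - 1) [\<alpha>]) R"
    by (simp add: prod_bit bor_mult_distrib)
  also have "\<dots> = formula n ps (Suc j)"
    using j by (simp add: formula_def R_def split: nat.split)
  finally show ?case .
qed


section \<open>Timed substitution\<close>

text \<open>A Hoare-style judgement for value and cost together. Quantifying over the initial
  counter makes it compose under \<open>bind\<close>.\<close>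

definition runs :: "'a timed \<Rightarrow> ('a \<Rightarrow> bool) \<Rightarrow> nat \<Rightarrow> bool" where
  "runs c Q b \<longleftrightarrow> (\<forall>t. Q (fst (run_state c t)) \<and> snd (run_state c t) \<le> t + b)"

lemma runs_return: "Q a \<Longrightarrow> runs (State_Monad.return a) Q b"
  by (simp add: runs_def)

lemma runs_step: "Q a \<Longrightarrow> 1 \<le> b \<Longrightarrow> runs (step a) Q b"
  by (simp add: runs_def step_def)

lemma runs_bind:
  assumes "runs c Q b" "\<And>a. Q a \<Longrightarrow> runs (f a) Q' b'" "b + b' \<le> b''"
  shows "runs (State_Monad.bind c f) Q' b''"
  unfolding runs_def
proof
  fix t
  have c: "Q (fst (run_state c t))" "snd (run_state c t) \<le> t + b"
    using assms(1) by (auto simp: runs_def)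
  then have "Q' (fst (run_state (f (fst (run_state c t))) (snd (run_state c t))))"
    "snd (run_state (f (fst (run_state c t))) (snd (run_state c t))) \<le> snd (run_state c t) + b'"
    using assms(2) by (auto simp: runs_def)
  then show "Q' (fst (run_state (State_Monad.bind c f) t)) \<and>
      snd (run_state (State_Monad.bind c f) t) \<le> t + b''"
    using c assms(3) by (simp add: split_beta)
qed

lemma runs_result: "runs c Q b \<Longrightarrow> Q (result c)"
  by (simp add: runs_def result_def)

lemma runs_time: "runs c Q b \<Longrightarrow> time c \<le> b"
  by (auto simp: runs_def time_def dest: spec[where x = 0])

section \<open>Substitution in stored clauses, polynomials and sets\<close>

lemma finite_stored_clause: "is_stored_clause n A \<Longrightarrow> finite A"
  unfolding is_stored_clause_def by (auto intro: finite_subset)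

lemma subst_symbol_val:
  "subst i \<alpha> (symbol_val s) =
    (if s = (if \<alpha> = 0 then Pos i else Neg i) then 0
     else if s = (if \<alpha> = 0 then Neg i else Pos i) then 1 else symbol_val s)"
  by (cases \<alpha>; cases s) (auto simp: subst_add subst_X)

lemma is_stored_clause_empty: "is_stored_clause n {}"
  by (simp add: is_stored_clause_def)

lemma is_stored_clause_One: "is_stored_clause n {One}"
  by (simp add: is_stored_clause_def)

lemma clause_val_empty: "clause_val {} = 0"
  by (simp add: clause_val_def)

lemma clause_val_One: "clause_val {One} = 1"
  by (simp add: clause_val_def)

text \<open>The cases are the branches of the program. The longest one takes five steps: two
  searches, a deletion, the test for emptiness and the creation of \<open>{One}\<close>.\<close>

lemma subst_clause_runs:
  assumes A: "is_stored_clause n A"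
  shows "runs (subst_clause i \<alpha> A)
    (\<lambda>B. is_stored_clause n B \<and> clause_val B = subst i \<alpha> (clause_val A)) 5"
proof -
  define s0 where "s0 = (if \<alpha> = 0 then Pos i else Neg i)"
  define s1 where "s1 = (if \<alpha> = 0 then Neg i else Pos i)"
  have fin: "finite A"
    using A by (rule finite_stored_clause)
  have symbol: "subst i \<alpha> (symbol_val s) = (if s = s0 then 0 else if s = s1 then 1 else symbol_val s)" for s
    by (simp add: subst_symbol_val s0_def s1_def)
  have val: "subst i \<alpha> (clause_val A) = (if A = {} then 0 else \<Prod>s \<in> A. subst i \<alpha> (symbol_val s))"
    by (simp add: clause_val_def subst_prod)
  consider "s0 \<in> A" | "s0 \<notin> A" "s1 \<in> A" | "s0 \<notin> A" "s1 \<notin> A"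
    by blast
  then show ?thesis
  proof cases
    case 1
    then have "subst i \<alpha> (clause_val A) = 0"
      unfolding val using fin by (auto intro!: prod_zero bexI[of _ s0] simp: symbol)
    then show ?thesis
      using 1 by (simp add: subst_clause_def runs_def step_def is_stored_clause_empty clause_val_empty
          flip: s0_def s1_def)
  next
    case 2
    have "subst i \<alpha> (clause_val A) = (\<Prod>s \<in> A. subst i \<alpha> (symbol_val s))"
      unfolding val using 2 by auto
    also have "\<dots> = subst i \<alpha> (symbol_val s1) * (\<Prod>s \<in> A - {s1}. subst i \<alpha> (symbol_val s))"
      using fin 2(2) by (rule prod.remove)
    also have "\<dots> = (\<Prod>s \<in> A - {s1}. symbol_val s)"
      using 2 by (auto simp: symbol intro!: prod.cong split: if_splits)
    finally have "subst i \<alpha> (clause_val A) = (\<Prod>s \<in> A - {s1}. symbol_val s)" .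
    moreover have "is_stored_clause n (A - {s1})"
      using A 2 by (auto simp: is_stored_clause_def s1_def)
    \<comment> \<open>If \<open>s1\<close> was the only literal, the remaining product is 1, whereas
      the empty set stands for 0; hence the switch to \<open>{One}\<close>.\<close>
    ultimately have "is_stored_clause n (if A - {s1} = {} then {One} else A - {s1}) \<and>
        clause_val (if A - {s1} = {} then {One} else A - {s1}) = subst i \<alpha> (clause_val A)"
      by (cases "A - {s1} = {}") (simp_all add: is_stored_clause_One clause_val_def)
    then show ?thesis
      using 2 by (cases "A - {s1} = {}")
        (simp_all add: subst_clause_def runs_def step_def flip: s0_def s1_def)
  next
    case 3
    then have "subst i \<alpha> (clause_val A) = clause_val A"
      unfolding val by (auto simp: clause_val_def symbol intro!: prod.cong split: if_splits)
    then show ?thesis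
      using 3 A by (simp add: subst_clause_def runs_def step_def flip: s0_def s1_def)
  qed
qed

lemma subst_poly_runs:
  assumes "is_stored_poly n l q"
  shows "runs (subst_poly i \<alpha> q)
    (\<lambda>r. is_stored_poly n l r \<and> poly_val r = subst i \<alpha> (poly_val q)) (5 * l)"
proof -
  \<comment> \<open>The fixed \<open>l\<close> is replaced by the length of the list, so that
    induction on the list applies.\<close>
  have "runs (State_Monad.traverse_list (subst_clause i \<alpha>) q)
      (\<lambda>r. is_stored_poly n (length q) r \<and> poly_val r = subst i \<alpha> (poly_val q)) (5 * length q)"
    if "\<forall>A \<in> set q. is_stored_clause n A"
    using that
  proof (induction q)
    case Nil
    show ?case
      by (simp add: runs_return is_stored_poly_def poly_val_def)
  next
    case (Cons A q)
    have IH: "runs (State_Monad.traverse_list (subst_clause i \<alpha>) q)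
        (\<lambda>r. is_stored_poly n (length q) r \<and> poly_val r = subst i \<alpha> (poly_val q)) (5 * length q)"
      using Cons by simp
    have A: "is_stored_clause n A"
      using Cons.prems by simp
    show ?case
      unfolding State_Monad.traverse_list.simps
    proof (rule runs_bind[OF subst_clause_runs[OF A]], rule runs_bind[OF IH])
      fix B r
      assume "is_stored_clause n B \<and> clause_val B = subst i \<alpha> (clause_val A)"
        "is_stored_poly n (length q) r \<and> poly_val r = subst i \<alpha> (poly_val q)"
      then show "runs (State_Monad.return (B # r)) (\<lambda>r. is_stored_poly n (length (A # q)) r
          \<and> poly_val r = subst i \<alpha> (poly_val (A # q))) 0"
        by (intro runs_return) (auto simp: is_stored_poly_def poly_val_def subst_add)
    qed (rule order.refl, simp)
  qed
  then show ?thesis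
    using assms by (auto simp: is_stored_poly_def subst_poly_def)
qed

lemma insert_poly_runs:
  assumes "is_stored_poly n l q" "stores n l Q P"
  shows "runs (insert_poly q Q) (\<lambda>R. stores n l R (insert (poly_val q) P)) 1"
  unfolding insert_poly_def using assms by (intro runs_step) (auto simp: stores_def)

text \<open>Each polynomial costs at most \<open>5 * l\<close> steps plus one insertion. Insertion
  compares values, so the output stays free of repetitions even when polynomials collapse.\<close>

lemma subst_set_runs:
  assumes "\<forall>q \<in> set Q. is_stored_poly n l q"
  shows "runs (subst_set i \<alpha> Q) (\<lambda>R. stores n l R (subst i \<alpha> ` poly_val ` set Q))
    ((5 * l + 1) * length Q)"
  using assms
proof (induction Q)
  case Nil
  show ?case
    by (simp add: runs_return stores_def)
next
  case (Cons q Q)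
  have IH: "runs (subst_set i \<alpha> Q) (\<lambda>R. stores n l R (subst i \<alpha> ` poly_val ` set Q))
      ((5 * l + 1) * length Q)"
    using Cons by simp
  have q: "is_stored_poly n l q"
    using Cons.prems by simp
  show ?case
    unfolding subst_set.simps
  proof (rule runs_bind[OF subst_poly_runs[OF q]], rule runs_bind[OF IH])
    fix q' Q'
    assume "is_stored_poly n l q' \<and> poly_val q' = subst i \<alpha> (poly_val q)"
      "stores n l Q' (subst i \<alpha> ` poly_val ` set Q)"
    then show "runs (insert_poly q' Q')
        (\<lambda>R. stores n l R (subst i \<alpha> ` poly_val ` set (q # Q))) 1"
      using insert_poly_runs[of n l q' Q'] by simp
  qed (rule order.refl, simp)
qed

lemma norm_set_runs:
  assumes "stores n l Q P"
  shows "runs (norm_set Q) (\<lambda>R. stores n l R (\<N> P)) 2"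
  unfolding norm_set_def
proof (rule runs_bind[where b = 1 and b' = 1])
  show "runs (step (1 \<in> poly_val ` set Q)) (\<lambda>b. b \<longleftrightarrow> 1 \<in> poly_val ` set Q) 1"
    by (simp add: runs_step)
next
  fix b assume "b \<longleftrightarrow> 1 \<in> poly_val ` set Q"
  then show "runs (if b then step (filter (\<lambda>q. poly_val q = 1) Q)
      else step (filter (\<lambda>q. poly_val q \<noteq> 0) Q)) (\<lambda>R. stores n l R (\<N> P)) 1"
    using assms
    by (auto intro!: runs_step simp: stores_def \<N>_def distinct_map_filter)
qed simp

lemma stores_length: "stores n l Q P \<Longrightarrow> length Q = card P"
  unfolding stores_def using distinct_card[of "map poly_val Q"] by auto

lemma next_set_runs:
  assumes "stores n l Q P" "1 \<le> l"
  shows "runs (next_set i \<alpha> Q) (\<lambda>R. stores n l R (\<N> (subst i \<alpha> ` P))) (8 * l * card P)"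
\<comment> \<open>For an empty set the bound is 0, which the uncharged branch of
  \<open>next_set\<close> meets.\<close>
proof (cases "Q = []")
  case True
  then show ?thesis
    using assms by (auto simp: next_set_def stores_def \<N>_def intro!: runs_return)
next
  case False
  \<comment> \<open>As \<open>l\<close> and the length are at least 1, the insertions are absorbed
    by one multiple of \<open>l * length Q\<close> and the two steps of \<open>norm_set\<close> by
    two more: 5 + 1 + 2 = 8.\<close>
  have "(5 * l + 1) * length Q + 2 \<le> 8 * l * length Q"
  proof -
    have Q: "1 \<le> length Q"
      using False by (simp add: Suc_le_eq)
    have "1 \<le> l * length Q"
      using mult_le_mono[OF assms(2) Q] by simp
    moreover have "length Q \<le> l * length Q"
      using assms(2) by simp
    moreover have "(5 * l + 1) * length Q = 5 * (l * length Q) + length Q"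
      "8 * l * length Q = 8 * (l * length Q)"
      by (simp_all add: algebra_simps)
    ultimately show ?thesis
      by linarith
  qed
  then have bound: "(5 * l + 1) * length Q + 2 \<le> 8 * l * card P"
    by (simp only: stores_length[OF assms(1)])
  have "runs (subst_set i \<alpha> Q) (\<lambda>R. stores n l R (subst i \<alpha> ` P)) ((5 * l + 1) * length Q)"
    using assms subst_set_runs[of Q n l i \<alpha>] by (simp add: stores_def)
  from runs_bind[OF this norm_set_runs bound] show ?thesis
    using False by (simp add: next_set_def)
qed

section \<open>Storing the families\<close>

definition storable :: "nat \<Rightarrow> nat \<Rightarrow> bpoly set" where
  "storable n l = poly_val ` {q. is_stored_poly n l q}"

text \<open>The output of \<open>subst_poly\<close> is itself the required stored form.\<close>

lemma subst_storable:
  assumes "p \<in> storable n l"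
  shows "subst i \<alpha> p \<in> storable n l"
proof -
  obtain q where q: "is_stored_poly n l q" "p = poly_val q"
    using assms by (auto simp: storable_def)
  show ?thesis
    using runs_result[OF subst_poly_runs[OF q(1), of i \<alpha>]] q(2) by (force simp: storable_def)
qed

lemma CL_stored:
  assumes "p \<in> CL n"
  shows "\<exists>A. is_stored_clause n A \<and> clause_val A = p"
proof -
  consider "p = 0" | "p = 1" | ls where "p = prod_list ls" "ls \<noteq> []" "set ls \<subseteq> literals n"
    "\<forall>a < length ls. \<forall>b < length ls. a \<noteq> b \<longrightarrow> ls ! a \<notin> {ls ! b, ls ! b + 1}"
    using assms unfolding CL_def by blast
  then show ?thesis
  proof cases
    case 1
    then show ?thesis
      using is_stored_clause_empty clause_val_empty by blast
  next
    case 2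
    then show ?thesis
      using is_stored_clause_One clause_val_One by blast
  next
    case 3
    have "\<exists>s \<in> Pos ` {1..n} \<union> Neg ` {1..n}. symbol_val s = x" if "x \<in> literals n" for x
      using that by (force simp: literals_def)
    then obtain g where g: "\<And>x. x \<in> literals n \<Longrightarrow>
        g x \<in> Pos ` {1..n} \<union> Neg ` {1..n} \<and> symbol_val (g x) = x"
      by metis
    \<comment> \<open>Complementary symbols would come from complementary literals at two different
      positions, which the definition of \<open>CL\<close> excludes.\<close>
    have "\<not> (Pos i \<in> g ` set ls \<and> Neg i \<in> g ` set ls)" for i
    proof
      assume "Pos i \<in> g ` set ls \<and> Neg i \<in> g ` set ls"
      then obtain x y where "x \<in> set ls" "y \<in> set ls" "Pos i = g x" "Neg i = g y"
        by blast
      moreover from this have xy: "x = X i" "y = X i + 1"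
        using g 3(3) by (metis subsetD symbol_val.simps)+
      ultimately obtain a b where ab: "a < length ls" "b < length ls" "ls ! a = X i" "ls ! b = X i + 1"
        by (metis in_set_conv_nth)
      then have "a \<noteq> b"
        by auto
      then show False
        using 3(4) ab by (metis insertCI)
    qed
    then have "is_stored_clause n (g ` set ls)"
      using g 3(3) unfolding is_stored_clause_def by blast
    moreover have "clause_val (g ` set ls) = p"
    proof -
      have "clause_val (g ` set ls) = (\<Prod>x \<in> set ls. symbol_val (g x))"
        using 3(2) by (simp add: clause_val_def prod_idem_image)
      also have "\<dots> = (\<Prod>x \<in> set ls. x)"
        using g 3(3) by (intro prod.cong) auto
      \<comment> \<open>Idempotence identifies the product over the list with that over its set of
        entries.\<close>
      also have "\<dots> = prod_list ls"
        by (induction ls) (simp_all add: prod_idem_insert)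
      finally show ?thesis
        using 3(1) by simp
    qed
    ultimately show ?thesis
      by blast
  qed
qed

lemma CL_sum_storable: "CL_sum n l \<subseteq> storable n l"
proof
  fix p assume "p \<in> CL_sum n l"
  then obtain cs where cs: "p = sum_list cs" "length cs = l" "set cs \<subseteq> CL n"
    by (auto simp: CL_sum_def)
  from bchoice[OF ballI[OF CL_stored]] obtain g
    where g: "\<forall>c \<in> CL n. is_stored_clause n (g c) \<and> clause_val (g c) = c" ..
  have "map (\<lambda>c. clause_val (g c)) cs = cs"
    using cs(3) g by (intro map_idI) auto
  then have "poly_val (map g cs) = p"
    using cs(1) by (simp add: poly_val_def comp_def)
  moreover have "is_stored_poly n l (map g cs)"
    using cs g by (auto simp: is_stored_poly_def)
  ultimately show "p \<in> storable n l"
    by (auto simp: storable_def)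
qed

lemma P_set_storable:
  assumes "ps \<in> Sat n l" "1 \<le> i" "i \<le> j" "length \<alpha>s = j - i"
  shows "P_set n ps j i \<alpha>s \<subseteq> storable n l"
  using assms(2-)
proof (induction rule: P_set_induct)
  case empty
  have "P_empty n ps i \<subseteq> set ps"
    using \<N>_subset[of "set ps"] by (auto simp: P_empty_def)
  then show ?case
    using assms(1) CL_sum_storable[of n l] unfolding Sat_def by blast
next
  case (step k \<alpha> P)
  then show ?case
    using \<N>_subset subst_storable by blast
qed

lemma storable_stores:
  assumes "finite P" "P \<subseteq> storable n l"
  shows "\<exists>Q. stores n l Q P"
proof -
  obtain xs where xs: "set xs = P" "distinct xs"
    using finite_distinct_list[OF assms(1)] by metis
  obtain g where g: "\<And>p. p \<in> P \<Longrightarrow> is_stored_poly n l (g p) \<and> poly_val (g p) = p"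
    using assms(2) unfolding storable_def subset_iff image_iff Bex_def mem_Collect_eq by metis
  have "map (\<lambda>p. poly_val (g p)) xs = xs"
    using xs(1) g by (intro map_idI) auto
  then have "stores n l (map g xs) P"
    using xs g by (force simp: stores_def comp_def image_image)
  then show ?thesis ..
qed

text \<open>Guarantees that the time bound, which is stated for every such \<open>R\<close>, is not
  vacuous.\<close>

lemma stores_family_exists:
  assumes "ps \<in> Sat n l"
  shows "\<exists>R. stores_family n l ps j R"
proof -
  define R where "R = (\<lambda>(i, \<alpha>s). SOME Q. stores n l Q (P_set n ps j i \<alpha>s))"
  have "stores n l (R (i, \<alpha>s)) (P_set n ps j i \<alpha>s)" if "i \<in> {1..j}" "length \<alpha>s = j - i" for i \<alpha>s
    unfolding R_def case_prod_conv using that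
    by (intro someI_ex[OF storable_stores[OF finite_P_set P_set_storable[OF assms]]]) auto
  then have "stores_family n l ps j R"
    unfolding stores_family_def by blast
  then show ?thesis by blast
qed

section \<open>Total time for one family\<close>

lemma next_member_runs:
  assumes "stores_family n l ps (j - 1) R" "1 \<le> l" "(i, \<alpha>s) \<in> dom (P_family n ps j)"
  shows "runs (next_member j R (i, \<alpha>s)) (\<lambda>Q. stores n l Q (the (P_family n ps j (i, \<alpha>s))))
    (8 * l * card (P_set n ps (j - 1) i (butlast \<alpha>s)))"
proof -
  from assms(3) have ix: "1 \<le> i" "i \<le> j - 1" "length \<alpha>s = j - i"
    unfolding dom_P_family by auto
  \<comment> \<open>An index in the domain forces \<open>j\<close> to be at least 2.\<close>
  then obtain k where j: "j = Suc k" "1 \<le> k"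
    by (cases j) auto
  have "the (P_family n ps j (i, \<alpha>s)) = \<N> (subst k (last \<alpha>s) ` P_set n ps k i (butlast \<alpha>s))"
    using ix j by (simp add: P_family_Suc del: P_family.simps)
  moreover have "stores n l (R (i, butlast \<alpha>s)) (P_set n ps k i (butlast \<alpha>s))"
    using assms(1) ix j unfolding stores_family_def by auto
  ultimately show ?thesis
    using next_set_runs[OF _ assms(2)] j by (simp add: next_member_def)
qed

text \<open>Each tuple has exactly two extensions by a last bit, so each set of the previous stage
  is paid for twice.\<close>

lemma sum_butlast:
  fixes f :: "bit list \<Rightarrow> nat"
  shows "(\<Sum>\<alpha>s | length \<alpha>s = Suc k. f (butlast \<alpha>s)) = 2 * (\<Sum>\<beta>s | length \<beta>s = k. f \<beta>s)"
proof -
  have "(\<Sum>\<alpha>s | length \<alpha>s = Suc k. f (butlast \<alpha>s))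
      = (\<Sum>(\<beta>s, \<alpha>) \<in> {\<beta>s. length \<beta>s = k} \<times> (UNIV :: bit set). f \<beta>s)"
    by (intro sum.reindex_bij_witness[where i = "\<lambda>(\<beta>s, \<alpha>). \<beta>s @ [\<alpha>]"
          and j = "\<lambda>\<alpha>s. (butlast \<alpha>s, last \<alpha>s)"]) (auto intro!: append_butlast_last_id)
  also have "\<dots> = (\<Sum>\<beta>s | length \<beta>s = k. 2 * f \<beta>s)"
    by (simp add: UNIV_bit mult_2 flip: sum.cartesian_product)
  finally show ?thesis
    by (simp add: sum_distrib_left)
qed

lemma family_time_le:
  assumes "stores_family n l ps (j - 1) R" "1 \<le> l"
  shows "family_time n ps j R
    \<le> 16 * (l * (\<Sum>i = 1..j - 1. \<Sum>\<alpha>s | length \<alpha>s = j - 1 - i. card (P_set n ps (j - 1) i \<alpha>s)))"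
proof -
  let ?c = "\<lambda>i \<alpha>s. card (P_set n ps (j - 1) i \<alpha>s)"
  have "family_time n ps j R \<le> (\<Sum>(i, \<alpha>s) \<in> dom (P_family n ps j). 8 * l * ?c i (butlast \<alpha>s))"
    unfolding family_time_def
  proof (rule sum_mono)
    fix ix assume "ix \<in> dom (P_family n ps j)"
    then show "time (next_member j R ix) \<le> (case ix of (i, \<alpha>s) \<Rightarrow> 8 * l * ?c i (butlast \<alpha>s))"
      using runs_time[OF next_member_runs[OF assms]] by (cases ix) simp
  qed
  also have "\<dots> = (\<Sum>i = 1..j - 1. \<Sum>\<alpha>s | length \<alpha>s = j - i. 8 * l * ?c i (butlast \<alpha>s))"
    unfolding dom_P_family by (intro sum.Sigma[symmetric]) (auto simp: finite_bit_lists)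
  \<comment> \<open>The constant is 16 = 2 * 8: two successors per set, each at cost factor
    8.\<close>
  also have "\<dots> = (\<Sum>i = 1..j - 1. 16 * l * (\<Sum>\<beta>s | length \<beta>s = j - 1 - i. ?c i \<beta>s))"
  proof (rule sum.cong)
    fix i assume "i \<in> {1..j - 1}"
    then have "j - i = Suc (j - 1 - i)"
      by auto
    then show "(\<Sum>\<alpha>s | length \<alpha>s = j - i. 8 * l * ?c i (butlast \<alpha>s))
        = 16 * l * (\<Sum>\<beta>s | length \<beta>s = j - 1 - i. ?c i \<beta>s)"
      using sum_butlast[of "?c i" "j - 1 - i"] by (simp flip: sum_distrib_left)
  qed simp
  finally show ?thesis
    by (simp add: mult.assoc flip: sum_distrib_left)
qed

text \<open>\<open>C\<close> is quantified first and is thus uniform in the system, its parameters,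
  the stage and the chosen storage \<open>R\<close>.\<close>

theorem theorem3p1:
  "\<exists>C :: nat. \<forall>(n :: nat) (l :: nat) (ps :: bpoly list). l \<ge> 1 \<and> ps \<in> Sat n l \<longrightarrow>
     (\<forall>j \<in> {1..n + 1}.
        P_poly ps j = formula n ps j
      \<and> (\<forall>P \<in> ran (P_family n ps j). P \<subseteq> BP j n)
      \<and> card (dom (P_family n ps j)) = 2 ^ j - 2
      \<and> (j \<ge> 2 \<longrightarrow> (\<forall>i \<in> {1..j - 1}. \<forall>\<alpha>s. length \<alpha>s = j - i \<longrightarrow>
           card (P_set n ps j i \<alpha>s) \<le> card (P_set n ps (j - 1) i (butlast \<alpha>s))))
      \<and> (\<exists>R. stores_family n l ps (j - 1) R)
      \<and> (\<forall>R. stores_family n l ps (j - 1) R \<longrightarrow>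
           (\<forall>ix \<in> dom (P_family n ps j).
              stores n l (result (next_member j R ix)) (the (P_family n ps j ix)))
         \<and> family_time n ps j R
             \<le> C * (l * (\<Sum>i = 1..j - 1. \<Sum>\<alpha>s | length \<alpha>s = j - 1 - i.
                          card (P_set n ps (j - 1) i \<alpha>s)))))"
proof (intro exI[of _ 16] allI impI ballI conjI)
  fix n l :: nat and ps :: "bpoly list" and j :: nat
  assume "l \<ge> 1 \<and> ps \<in> Sat n l" and j: "j \<in> {1..n + 1}"
  then have l: "1 \<le> l" and Sat: "ps \<in> Sat n l"
    by auto
  have ps: "set ps \<subseteq> BP 1 n"
    using Sat CL_sum_subset_BP by (auto simp: Sat_def)
  show "P_poly ps j = formula n ps j"
    using P_poly_eq_formula[OF ps] j by simp
  show "P \<subseteq> BP j n" if "P \<in> ran (P_family n ps j)" for P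
  proof -
    from that obtain i \<alpha>s where P: "P_family n ps j (i, \<alpha>s) = Some P"
      by (auto simp: ran_def)
    then have "(i, \<alpha>s) \<in> dom (P_family n ps j)"
      by blast
    then have ix: "1 \<le> i" "i \<le> j - 1" "length \<alpha>s = j - i"
      unfolding dom_P_family by auto
    \<comment> \<open>Here \<open>i < j\<close>, so \<open>P_member\<close> reads the family and not
      \<open>P_empty\<close>.\<close>
    then have "P = P_set n ps j i \<alpha>s"
      using P by (auto simp: P_member_def)
    then show ?thesis
      using P_set_BP[OF ps] ix by simp
  qed
  show "card (dom (P_family n ps j)) = 2 ^ j - 2"
    by (rule card_dom_P_family)
  show "card (P_set n ps j i \<alpha>s) \<le> card (P_set n ps (j - 1) i (butlast \<alpha>s))"
    if "2 \<le> j" "i \<in> {1..j - 1}" "length \<alpha>s = j - i" for i \<alpha>s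
    using card_P_set_Suc_le[of i "j - 1" \<alpha>s n ps] that by simp
  \<comment> \<open>For \<open>j = 1\<close> this concerns stage 0, where the index range is empty
    and any \<open>R\<close> will do.\<close>
  show "\<exists>R. stores_family n l ps (j - 1) R"
    using Sat by (rule stores_family_exists)
  show "stores n l (result (next_member j R ix)) (the (P_family n ps j ix))"
    if "stores_family n l ps (j - 1) R" "ix \<in> dom (P_family n ps j)" for R ix
    using runs_result[OF next_member_runs[OF that(1) l]] that(2) by (cases ix) simp
  show "family_time n ps j R
      \<le> 16 * (l * (\<Sum>i = 1..j - 1. \<Sum>\<alpha>s | length \<alpha>s = j - 1 - i. card (P_set n ps (j - 1) i \<alpha>s)))"
    if "stores_family n l ps (j - 1) R" for R
    using that l by (rule family_time_le)
qed

end
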